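(* We have the identity \[\sum_{k=1}^\infty \frac{(13k^2-15k+2)\,9^{k-1}}{k(3k-1)(3k-2)\binom{4k}{k}}=\frac{\pi\sqrt3}{3}.\] *)

theory Defs
  imports "HOL-Analysis.Analysis"
begin

end

theory Submission
  imports Defs
begin

text \<open>
  Up to the factor \<open>-3/2\<close>, the term with index \<open>n = k - 1\<close> is a combination of Beta integrals, namely the integral over
  \<open>[0,1]\<close> of \<open>(1 - 3x + 3x\<^sup>2/2) (9 x\<^sup>3 (1 - x)) ^ n\<close>. Since \<open>9 x\<^sup>3 (1 - x) \<le> 243/256\<close> there, the
  geometric series may be summed under the integral. The resulting denominator
  \<open>1 - 9x\<^sup>3 + 9x\<^sup>4\<close> is the squared modulus of
  \<open>g(x) = (1 - 3x\<^sup>2/2) + i \<surd>3 (x - 3x\<^sup>2/2)\<close>, and the integrand is \<open>1/\<surd>3\<close> times the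
  derivative of the argument of \<open>g\<close>, which changes by \<open>-2\<pi>/3\<close> along \<open>[0,1]\<close>.
\<close>

text \<open>The Beta integral at integer arguments, by integration by parts. Each step trades a
  factor \<open>1 - x\<close> for a factor \<open>x\<close>, so \<open>a\<close> must vary in the
  induction on \<open>b\<close>.\<close>

lemma has_integral_power_mult_power_one_minus:
  fixes a b :: nat
  shows "((\<lambda>x::real. x ^ a * (1 - x) ^ b) has_integral fact a * fact b / fact (a + b + 1)) {0..1}"
proof (induction b arbitrary: a)
  case 0
  have "((\<lambda>x::real. x ^ a) has_integral 1 ^ Suc a / (real a + 1) - 0 ^ Suc a / (real a + 1)) {0..1}"
    by (intro fundamental_theorem_of_calculus)
       (auto intro!: derivative_eq_intros
             simp flip: has_real_derivative_iff_has_vector_derivative simp: add.commute simp del: power_Suc)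
  moreover have "1 ^ Suc a / (real a + 1) - 0 ^ Suc a / (real a + 1) = fact a * fact 0 / fact (a + 0 + 1)"
    by (simp add: add.commute)
  ultimately show ?case by (simp only: power_0 mult_1_right)
next
  case (Suc b)
  \<comment> \<open>The boundary term of the integration by parts; it vanishes at both
    endpoints.\<close>
  let ?G = "\<lambda>x::real. x ^ Suc a * (1 - x) ^ Suc b / (real a + 1)"
  have "(?G has_real_derivative
          x ^ a * (1 - x) ^ Suc b - (real b + 1) / (real a + 1) * (x ^ Suc a * (1 - x) ^ b))
          (at x within {0..1})" for x
  proof -
    have "real a + 1 \<noteq> 0" "1 + real a \<noteq> 0" by linarith+
    thus ?thesis
      by - ((rule derivative_eq_intros refl | assumption)+, simp add: divide_simps, simp add: algebra_simps)
  qed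
  hence "((\<lambda>x::real. x ^ a * (1 - x) ^ Suc b - (real b + 1) / (real a + 1) * (x ^ Suc a * (1 - x) ^ b))
          has_integral ?G 1 - ?G 0) {0..1}"
    by (intro fundamental_theorem_of_calculus)
       (auto simp flip: has_real_derivative_iff_has_vector_derivative)
  from has_integral_add[OF this has_integral_mult_right[OF Suc.IH[of "Suc a"], of "(real b + 1) / (real a + 1)"]]
  have "((\<lambda>x::real. x ^ a * (1 - x) ^ Suc b) has_integral
          (real b + 1) / (real a + 1) * (fact (Suc a) * fact b / fact (Suc a + b + 1))) {0..1}"
    by simp
  also have "(real b + 1) / (real a + 1) * (fact (Suc a) * fact b / fact (Suc a + b + 1))
      = fact a * fact (Suc b) / fact (a + Suc b + 1)"
    by (simp add: divide_simps del: of_nat_Suc) (simp add: algebra_simps)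
  finally show ?case .
qed

lemma nine_cube_mult_one_minus_le:
  fixes x :: real
  shows "9 * (x ^ 3 * (1 - x)) \<le> 243 / 256"
proof -
  \<comment> \<open>The quartic attains its maximum at 3/4, hence the double root there; the
    remaining quadratic factor is positive.\<close>
  have "243 / 256 - 9 * (x ^ 3 * (1 - x)) = 9 * (x - 3/4)\<^sup>2 * ((x + 1/4)\<^sup>2 + 1/8)"
    by (simp add: power2_eq_square power3_eq_cube algebra_simps)
  also have "\<dots> \<ge> 0" by simp
  finally show ?thesis by simp
qed

text \<open>With g as above, \<open>sqrt 3 * kernel_numer x\<close> is the imaginary part of conj(g)
  g', the numerator of the derivative of arg g.\<close>

definition kernel_numer :: "real \<Rightarrow> real"
  where "kernel_numer x = 1 - 3 * x + 3/2 * x\<^sup>2"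

text \<open>Multiplying \<open>g\<close> by \<open>exp (i\<pi>/3)\<close> moves it into the right half-plane, so that its argument is
  an arctangent on all of \<open>[0,1]\<close>.\<close>

lemma has_integral_kernel:
  "((\<lambda>x. kernel_numer x / (1 - 9 * (x ^ 3 * (1 - x)))) has_integral - (2 * pi / (3 * sqrt 3))) {0..1}"
proof -
  let ?F = "\<lambda>x. arctan (sqrt 3 * (1 + x - 3 * x\<^sup>2) / (1 - 3 * x + 3 * x\<^sup>2)) / sqrt 3"
  have "(?F has_real_derivative kernel_numer x / (1 - 9 * (x ^ 3 * (1 - x)))) (at x within {0..1})"
    for x :: real
  proof -
    \<comment> \<open>\<open>?v\<close> and \<open>sqrt 3 * ?u\<close> are twice the real and
      imaginary parts of exp(i pi/3) g(x). This doubling causes the factor 4 in both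
      \<open>sq\<close> and \<open>num\<close>.\<close>
    let ?u = "1 + x - 3 * x\<^sup>2" and ?v = "1 - 3 * x + 3 * x\<^sup>2"
    have "?v = 3 * (x - 1/2)\<^sup>2 + 1/4"
      by (simp add: power2_eq_square algebra_simps)
    also have "\<dots> > 0" by (simp add: add_nonneg_pos)
    finally have v: "?v > 0" .
    have sq: "?v\<^sup>2 + 3 * ?u\<^sup>2 = 4 * (1 - 9 * (x ^ 3 * (1 - x)))"
      by (simp add: power2_eq_square power3_eq_cube algebra_simps)
    have num: "(1 - 6 * x) * ?v - ?u * (6 * x - 3) = 4 * kernel_numer x"
      by (simp add: kernel_numer_def power2_eq_square algebra_simps)
    have "((\<lambda>x. sqrt 3 * (1 + x - 3 * x\<^sup>2) / (1 - 3 * x + 3 * x\<^sup>2)) has_real_derivative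
            sqrt 3 * ((1 - 6 * x) * ?v - ?u * (6 * x - 3)) / ?v\<^sup>2) (at x within {0..1})"
      using v by (auto intro!: derivative_eq_intros simp: power2_eq_square algebra_simps)
    hence "(?F has_real_derivative
            inverse (1 + (sqrt 3 * ?u / ?v)\<^sup>2) * (sqrt 3 * (4 * kernel_numer x) / ?v\<^sup>2) / sqrt 3)
            (at x within {0..1})"
      unfolding num by (intro DERIV_cdivide DERIV_chain2[OF DERIV_arctan])
    moreover have "inverse (1 + (sqrt 3 * ?u / ?v)\<^sup>2) = ?v\<^sup>2 / (4 * (1 - 9 * (x ^ 3 * (1 - x))))"
    proof -
      have "1 + (sqrt 3 * ?u / ?v)\<^sup>2 = (?v\<^sup>2 + 3 * ?u\<^sup>2) / ?v\<^sup>2"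
        using v by (simp add: power_divide power_mult_distrib add_divide_distrib)
      thus ?thesis unfolding sq by simp
    qed
    moreover have "?v\<^sup>2 / (4 * d) * (sqrt 3 * (4 * k) / ?v\<^sup>2) / sqrt 3 = k / d" for d k
      using v by simp
    ultimately show ?thesis by (simp only:)
  qed
  \<comment> \<open>The rotated argument falls from pi/3 at 0 to -pi/3 at 1.\<close>
  hence "((\<lambda>x. kernel_numer x / (1 - 9 * (x ^ 3 * (1 - x)))) has_integral ?F 1 - ?F 0) {0..1}"
    by (intro fundamental_theorem_of_calculus)
       (auto simp flip: has_real_derivative_iff_has_vector_derivative)
  moreover have "arctan (sqrt 3) = pi / 3"
    by (rule arctan_unique) (use pi_gt_zero in \<open>auto simp: tan_60 simp del: pi_gt_zero\<close>)
  ultimately show ?thesis by (simp add: arctan_minus field_simps)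
qed

text \<open>Expanding \<open>kernel_numer\<close> gives three Beta integrals with weights 1, -3 and
  3/2. The factor n (13n + 11) is 13k^2 - 15k + 2 at k = n + 1.\<close>

lemma has_integral_kernel_numer_mult_power:
  "((\<lambda>x. kernel_numer x * (9 * (x ^ 3 * (1 - x))) ^ n) has_integral
      - (real n * (13 * real n + 11) * 9 ^ n * fact (3 * n) * fact n / (2 * fact (4 * n + 3)))) {0..1}"
proof -
  let ?I = "\<lambda>j. fact (3 * n + j) * fact n / fact (3 * n + j + n + 1) :: real"
  have "((\<lambda>x::real. 9 ^ n * (x ^ (3 * n + 0) * (1 - x) ^ n - 3 * (x ^ (3 * n + 1) * (1 - x) ^ n)
           + 3/2 * (x ^ (3 * n + 2) * (1 - x) ^ n)))
         has_integral 9 ^ n * (?I 0 - 3 * ?I 1 + 3/2 * ?I 2)) {0..1}"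
    by (intro has_integral_mult_right has_integral_add has_integral_diff
              has_integral_power_mult_power_one_minus)
  moreover have "9 ^ n * (x ^ (3 * n + 0) * (1 - x) ^ n - 3 * (x ^ (3 * n + 1) * (1 - x) ^ n)
           + 3/2 * (x ^ (3 * n + 2) * (1 - x) ^ n)) = kernel_numer x * (9 * (x ^ 3 * (1 - x))) ^ n"
    for x :: real
  proof -
    have "(9 * (x ^ 3 * (1 - x))) ^ n = 9 ^ n * (x ^ (3 * n) * (1 - x) ^ n)"
      by (simp only: power_mult_distrib power_mult)
    thus ?thesis
      by (simp only: kernel_numer_def power_add) (simp add: power2_eq_square algebra_simps)
  qed
  moreover have "9 ^ n * (?I 0 - 3 * ?I 1 + 3/2 * ?I 2)
      = - (real n * (13 * real n + 11) * 9 ^ n * fact (3 * n) * fact n / (2 * fact (4 * n + 3)))"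
  proof -
    \<comment> \<open>Over the common denominator (4n+3)!, the claim reduces to (4n+2)(4n+3) -
      3(3n+1)(4n+3) + 3/2 (3n+1)(3n+2) = -n(13n+11)/2.\<close>
    define f :: real where "f = fact (4 * n + 1)"
    define g :: real where "g = fact (3 * n)"
    have f: "f > 0" by (simp add: f_def)
    have "fact (3 * n + 1) = (3 * real n + 1) * g"
      "fact (3 * n + 2) = (3 * real n + 2) * (3 * real n + 1) * g"
      by (simp_all add: g_def numeral_2_eq_2 algebra_simps)
    moreover have "fact (Suc (4 * n + 1)) = (4 * real n + 2) * f"
      "fact (Suc (Suc (4 * n + 1))) = (4 * real n + 3) * (4 * real n + 2) * f"
      unfolding f_def fact_Suc by (simp_all add: algebra_simps)
    moreover have "3 * n + 0 + n + 1 = 4 * n + 1" "3 * n + 1 + n + 1 = Suc (4 * n + 1)"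
      "3 * n + 2 + n + 1 = Suc (Suc (4 * n + 1))" "4 * n + 3 = Suc (Suc (4 * n + 1))" "3 * n + 0 = 3 * n"
      by simp_all
    ultimately have I: "?I 0 = g * fact n / f" "?I 1 = (3 * real n + 1) * g * fact n / ((4 * real n + 2) * f)"
      "?I 2 = (3 * real n + 2) * (3 * real n + 1) * g * fact n / ((4 * real n + 3) * (4 * real n + 2) * f)"
      "fact (4 * n + 3) = (4 * real n + 3) * (4 * real n + 2) * f"
      by (simp_all only: f_def g_def)
    have "4 * real n + 2 > 0" "4 * real n + 3 > 0" by simp_all
    thus ?thesis
      using f unfolding I g_def[symmetric]
      by (simp add: divide_simps) (simp add: algebra_simps)
  qed
  ultimately show ?thesis by (simp only:)
qed

text \<open>The geometric ratio stays below 243/256 < 1 on the whole interval, so the series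
  converges uniformly and sum and integral may be exchanged.\<close>

lemma sums_integral_kernel_numer_mult_power:
  "(\<lambda>n. integral {0..1} (\<lambda>x. kernel_numer x * (9 * (x ^ 3 * (1 - x))) ^ n))
     sums (- (2 * pi / (3 * sqrt 3)))"
proof -
  let ?t = "\<lambda>x::real. 9 * (x ^ 3 * (1 - x))"
  let ?f = "\<lambda>n x. kernel_numer x * ?t x ^ n"
  have t: "0 \<le> ?t x" "?t x \<le> 243 / 256" if "x \<in> {0..1}" for x
    using that nine_cube_mult_one_minus_le[of x] by auto
  \<comment> \<open>Majorant for the Weierstrass M-test; 4 is a crude bound for
    \<open>kernel_numer\<close> on the interval.\<close>
  have "norm (?f n x) \<le> 4 * (243 / 256) ^ n" if "x \<in> {0..1}" for n x
  proof -
    have "x\<^sup>2 \<le> 1" using that by (simp add: power_le_one)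
    hence "\<bar>kernel_numer x\<bar> \<le> 4"
      using that zero_le_power2[of x] unfolding kernel_numer_def abs_le_iff atLeastAtMost_iff by linarith
    moreover have "\<bar>?t x ^ n\<bar> \<le> (243 / 256) ^ n"
      using t[OF that] by (simp only: power_abs abs_of_nonneg power_mono)
    ultimately show ?thesis
      unfolding real_norm_def abs_mult by (intro mult_mono) auto
  qed
  moreover have "summable (\<lambda>n. 4 * (243 / 256) ^ n :: real)"
    by (intro summable_mult summable_geometric) simp
  ultimately have "uniform_limit {0..1} (\<lambda>N x. \<Sum>n<N. ?f n x) (\<lambda>x. \<Sum>n. ?f n x) sequentially"
    by (intro Weierstrass_m_test) auto
  also have "?this \<longleftrightarrow> uniform_limit {0..1} (\<lambda>N x. \<Sum>n<N. ?f n x) (\<lambda>x. kernel_numer x / (1 - ?t x)) sequentially"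
  proof (intro uniform_limit_cong' refl)
    fix x :: real assume "x \<in> {0..1}"
    hence "\<bar>?t x\<bar> < 1" using t[of x] by linarith
    from sums_mult[OF geometric_sums, of "?t x" "kernel_numer x"] this
    have "(\<lambda>n. ?f n x) sums (kernel_numer x / (1 - ?t x))" by simp
    thus "(\<Sum>n. ?f n x) = kernel_numer x / (1 - ?t x)" by (simp add: sums_iff)
  qed
  finally have "uniform_limit (cbox 0 1) (\<lambda>N x. \<Sum>n<N. ?f n x) (\<lambda>x. kernel_numer x / (1 - ?t x)) sequentially"
    by simp
  moreover have "continuous_on (cbox 0 1) (\<lambda>x. \<Sum>n<N. ?f n x)" for N
    unfolding kernel_numer_def by (intro continuous_intros)
  ultimately obtain I J where
    I: "\<And>N. ((\<lambda>x. \<Sum>n<N. ?f n x) has_integral I N) (cbox 0 1)"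
    and J: "((\<lambda>x. kernel_numer x / (1 - ?t x)) has_integral J) (cbox 0 1)"
    and lim: "I \<longlonglongrightarrow> J"
    by (rule uniform_limit_integral_cbox) auto
  \<comment> \<open>\<open>I\<close> and \<open>J\<close> are known only as values of integrals;
    uniqueness of the integral identifies them with the partial sums and with the closed
    form.\<close>
  have "I = (\<lambda>N. \<Sum>n<N. integral {0..1} (?f n))"
  proof
    fix N
    have "((\<lambda>x. \<Sum>n<N. ?f n x) has_integral (\<Sum>n<N. integral {0..1} (?f n))) {0..1}"
      by (intro has_integral_sum integrable_integral finite_lessThan
                has_integral_integrable[OF has_integral_kernel_numer_mult_power])
    thus "I N = (\<Sum>n<N. integral {0..1} (?f n))"
      using has_integral_unique I[of N] by auto
  qed
  moreover have "J = - (2 * pi / (3 * sqrt 3))"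
    using has_integral_unique[OF J[unfolded cbox_interval] has_integral_kernel] .
  ultimately show ?thesis using lim by (simp only: sums_def)
qed

theorem theorem1:
  shows "(\<lambda>n::nat. let k = Suc n in
            (13 * (real k)\<^sup>2 - 15 * real k + 2) * 9 ^ (k - 1) /
            (real k * (3 * real k - 1) * (3 * real k - 2) * real ((4 * k) choose k)))
         sums (pi * sqrt 3 / 3)"
proof -
  have "(let k = Suc n in
            (13 * (real k)\<^sup>2 - 15 * real k + 2) * 9 ^ (k - 1) /
            (real k * (3 * real k - 1) * (3 * real k - 2) * real ((4 * k) choose k)))
        = - 3/2 * integral {0..1} (\<lambda>x. kernel_numer x * (9 * (x ^ 3 * (1 - x))) ^ n)" for n
  proof -
    define f :: real where "f = fact (4 * n + 3)"
    define g :: real where "g = fact (3 * n)"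
    define h :: real where "h = fact n"
    have pos: "f > 0" "g > 0" "h > 0" by (simp_all add: f_def g_def h_def)
    have "real ((4 * Suc n) choose Suc n) = fact (4 * Suc n) / (fact (Suc n) * fact (4 * Suc n - Suc n))"
      by (rule binomial_fact) simp
    also have "\<dots> = fact (Suc (4 * n + 3)) / (fact (Suc n) * fact (Suc (Suc (Suc (3 * n)))))"
    proof -
      have "4 * Suc n = Suc (4 * n + 3)" "4 * Suc n - Suc n = Suc (Suc (Suc (3 * n)))" by simp_all
      thus ?thesis by (simp only:)
    qed
    also have "\<dots> = (4 * real n + 4) * f / ((real n + 1) * h * ((3 * real n + 3) * (3 * real n + 2) * (3 * real n + 1) * g))"
      unfolding fact_Suc f_def g_def h_def by (simp add: algebra_simps)
    \<comment> \<open>In this form k (3k-1) (3k-2) cancels against the binomial, leaving 4 f / (3 g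
      h). Comparison with the factor -1/2 in \<open>int\<close> produces the constant -3/2.\<close>
    also have "\<dots> = 4 * f / (3 * (real n + 1) * (3 * real n + 2) * (3 * real n + 1) * h * g)"
      using pos by (simp add: divide_simps)
    finally have binom: "real ((4 * Suc n) choose Suc n) = \<dots>" .
    have int: "integral {0..1} (\<lambda>x. kernel_numer x * (9 * (x ^ 3 * (1 - x))) ^ n)
        = - (real n * (13 * real n + 11) * 9 ^ n * g * h / (2 * f))"
      unfolding f_def g_def h_def
      by (rule integral_unique) (rule has_integral_kernel_numer_mult_power)
    have numer: "13 * (real n + 1)\<^sup>2 - 15 * (real n + 1) + 2 = real n * (13 * real n + 11)"
      by (simp add: power2_eq_square algebra_simps)
    have factors: "real (Suc n) = real n + 1" "3 * (real n + 1) - 1 = 3 * real n + 2"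
      "3 * (real n + 1) - 2 = 3 * real n + 1" by simp_all
    have "real n + 1 > 0" "3 * real n + 2 > 0" "3 * real n + 1 > 0" by simp_all
    thus ?thesis
      unfolding Let_def binom int factors numer diff_Suc_1 using pos by (simp add: divide_simps)
  qed
  moreover have "- 3/2 * - (2 * pi / (3 * sqrt 3)) = pi * sqrt 3 / 3"
    by (simp add: field_simps)
  ultimately show ?thesis
    using sums_mult[OF sums_integral_kernel_numer_mult_power, of "- 3/2"] by (simp only:)
qed

end
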